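(* Let $(M,\eta^M,(-)^\dagger_M)$ be a monad on $\mathbf{Type}$ and suppose given a weak Mendler-style $M$-algebra on a universe $\mathbf{U}$, with extension operation $P\mapsto P^\star$, action $h\mapsto[h]^\star$ and witnesses $\mathsf{i}_P$, $\mathsf{j}_{Q,f}$. Then the following data form a monad $(T,\eta,(-)^\dagger)$ (in Kleisli triple form) on $\mathbf{Cont}(\mathbf{U})$: $T(A\triangleleft P)=MA\triangleleft P^\star$; $\eta_{A\triangleleft P}=\eta^M_A\triangleleft(\lambda\{a\}.\,\mathsf{i}_P\{a\})$; and for a container morphism $f\triangleleft g:A\triangleleft P\to T(B\triangleleft Q)$ (so $f:A\to MB$, $g:\prod_{\{a:A\}}(Q^\star(f\,a)\to P\,a)$), $(f\triangleleft g)^\dagger=f^\dagger_M\triangleleft\big(\lambda\{m\}.\,[g]^\star\{m\}\circ\mathsf{j}_{Q,f}\{m\}\big):T(A\triangleleft P)\to T(B\triangleleft Q)$.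
   Context: Work in extensional Martin-Löf type theory. For a universe $\mathbf{U}$, $\mathbf{Cont}(\mathbf{U})$ is the category of containers $A\triangleleft P$ ($A$ a type, $P:A\to\mathbf{U}$) with morphisms $f\triangleleft g:A\triangleleft P\to B\triangleleft Q$ given by $f:A\to B$, $g:\prod_{\{a:A\}}(Q(f\,a)\to P\,a)$, composition $(k\triangleleft l)\circ(f\triangleleft g)=(k\circ f)\triangleleft(\lambda\{a\}.\,g\{a\}\circ l\{f\,a\})$, identities pairs of identities. A monad in Kleisli-triple form on a category consists of an object map $T$, morphisms $\eta_A:A\to TA$ and an extension $f\mapsto f^\dagger:TA\to TB$ for $f:A\to TB$, with $\eta_A^\dagger=\mathrm{id}$, $f^\dagger\circ\eta_A=f$, $(g^\dagger\circ f)^\dagger=g^\dagger\circ f^\dagger$. A weak Mendler-style $M$-algebra on $\mathbf{U}$ consists of: (i) an extension operation sending every $P:A\to\mathbf{U}$ to $P^\star:MA\to\mathbf{U}$; (ii) an action sending every $h:\prod_{\{a:A\}}(P\,a\to Q\,a)$ (with $P,Q:A\to\mathbf{U}$) to $[h]^\star:\prod_{\{m:MA\}}(P^\star m\to Q^\star m)$; (iii) maps $\mathsf{i}_P:\prod_{\{a:A\}}(P^\star(\eta^M_A\,a)\to P\,a)$ for all $P:A\to\mathbf{U}$; (iv) maps $\mathsf{j}_{Q,f}:\prod_{\{m:MA\}}(Q^\star(f^\dagger_M\,m)\to(Q^\star\circ f)^\star\,m)$ for all $Q:B\to\mathbf{U}$, $f:A\to MB$; such that, for all $P,P':A\to\mathbf{U}$,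 $Q,Q':B\to\mathbf{U}$, $R:C\to\mathbf{U}$, $h:\prod_{\{a\}}(P\,a\to P'\,a)$, $h'$ a family map from $P'$ to a further family, $k:\prod_{\{b\}}(Q\,b\to Q'\,b)$, $f:A\to MB$, $g:B\to MC$, $a:A$, $m:MA$: (1) functoriality: $[\lambda\{a\}.\,\mathrm{id}_{P a}]^\star=\mathrm{id}$ and $[\lambda\{a\}.\,h'\{a\}\circ h\{a\}]^\star=[h']^\star\circ[h]^\star$; (2) naturality: $h\circ\mathsf{i}_P=\mathsf{i}_{P'}\circ[h]^\star$ at $\eta^M_A a$, and $[\lambda\{a\}.\,[k]^\star\{f\,a\}]^\star\circ\mathsf{j}_{Q,f}=\mathsf{j}_{Q',f}\circ[k]^\star$ at $f^\dagger_M m$; (3) coherence: $\mathsf{i}_{Q^\star\circ f}\circ\mathsf{j}_{Q,f}=\mathrm{id}$ on $Q^\star(f^\dagger_M(\eta^M_A a))=Q^\star(f\,a)$; $[\mathsf{i}_P]^\star\circ\mathsf{j}_{P,\eta^M_A}=\mathrm{id}$ on $P^\star((\eta^M_A)^\dagger_M m)=P^\star m$; and $\mathsf{j}_{R^\star\circ g,f}\circ\mathsf{j}_{R,g}=[\lambda\{a\}.\,\mathsf{j}_{R,g}\{f\,a\}]^\star\circ\mathsf{j}_{R,g^\dagger_M\circ f}$ as maps $R^\star((g^\dagger_M\circ f)^\dagger_M m)=R^\star(g^\dagger_M(f^\dagger_M m))\to((R^\star\circ g)^\star\circ f)^\star m$ (the equalities of types are instances of the monad laws of $M$). *)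

theory Defs
  imports "HOL-Library.FuncSet"
begin

text \<open>
  Extensional type theory is read in sets.  A type is a set of elements of a HOL type
  \<open>'v\<close>, and \<open>Ty\<close> is the collection of all types; a universe is a subcollection
  \<open>U \<subseteq> Ty\<close>.  No closure of \<open>Ty\<close> or \<open>U\<close> under type formers is required, so any
  family of sets that models the type formers is an instance.

  A (dependent) function is an extensional HOL function, i.e. an element of a \<open>PiE\<close> set, so
  that HOL equality is exactly equality of functions on their domain.  Implicit type and family
  arguments of the type theory become explicit arguments.
\<close>

text \<open>
  Hom-sets need not be disjoint: one extensional function has many codomains.  Identities,
  composition and Kleisli extension therefore take the objects as arguments:
  \<open>Comp C X Y Z g f\<close> is \<open>g \<circ> f\<close> for \<open>f : X \<rightarrow> Y\<close> and \<open>g : Y \<rightarrow> Z\<close>.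
\<close>

record ('o, 'm) cat =
  Obj :: "'o set"
  Hom :: "'o \<Rightarrow> 'o \<Rightarrow> 'm set"
  Idt :: "'o \<Rightarrow> 'm"
  Comp :: "'o \<Rightarrow> 'o \<Rightarrow> 'o \<Rightarrow> 'm \<Rightarrow> 'm \<Rightarrow> 'm"

locale category =
  fixes C :: "('o, 'm) cat"
  assumes Idt_Hom: "X \<in> Obj C \<Longrightarrow> Idt C X \<in> Hom C X X"
    and Comp_Hom: "\<lbrakk>X \<in> Obj C; Y \<in> Obj C; Z \<in> Obj C; f \<in> Hom C X Y; g \<in> Hom C Y Z\<rbrakk>
      \<Longrightarrow> Comp C X Y Z g f \<in> Hom C X Z"
    and Comp_Idt_right: "\<lbrakk>X \<in> Obj C; Y \<in> Obj C; f \<in> Hom C X Y\<rbrakk>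
      \<Longrightarrow> Comp C X X Y f (Idt C X) = f"
    and Comp_Idt_left: "\<lbrakk>X \<in> Obj C; Y \<in> Obj C; f \<in> Hom C X Y\<rbrakk>
      \<Longrightarrow> Comp C X Y Y (Idt C Y) f = f"
    and Comp_assoc: "\<lbrakk>W \<in> Obj C; X \<in> Obj C; Y \<in> Obj C; Z \<in> Obj C;
        f \<in> Hom C W X; g \<in> Hom C X Y; h \<in> Hom C Y Z\<rbrakk>
      \<Longrightarrow> Comp C W Y Z h (Comp C W X Y g f) = Comp C W X Z (Comp C X Y Z h g) f"

locale kleisli_triple = category C
  for C :: "('o, 'm) cat" +
  fixes T :: "'o \<Rightarrow> 'o"
    and eta :: "'o \<Rightarrow> 'm"
    and ext :: "'o \<Rightarrow> 'o \<Rightarrow> 'm \<Rightarrow> 'm"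
  assumes T_Obj: "X \<in> Obj C \<Longrightarrow> T X \<in> Obj C"
    and eta_Hom: "X \<in> Obj C \<Longrightarrow> eta X \<in> Hom C X (T X)"
    and ext_Hom: "\<lbrakk>X \<in> Obj C; Y \<in> Obj C; f \<in> Hom C X (T Y)\<rbrakk>
      \<Longrightarrow> ext X Y f \<in> Hom C (T X) (T Y)"
    and ext_eta: "X \<in> Obj C \<Longrightarrow> ext X X (eta X) = Idt C (T X)"
    and ext_comp_eta: "\<lbrakk>X \<in> Obj C; Y \<in> Obj C; f \<in> Hom C X (T Y)\<rbrakk>
      \<Longrightarrow> Comp C X (T X) (T Y) (ext X Y f) (eta X) = f"
    and ext_ext: "\<lbrakk>X \<in> Obj C; Y \<in> Obj C; Z \<in> Obj C; f \<in> Hom C X (T Y); g \<in> Hom C Y (T Z)\<rbrakk>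
      \<Longrightarrow> ext X Z (Comp C X (T Y) (T Z) (ext Y Z g) f)
          = Comp C (T X) (T Y) (T Z) (ext Y Z g) (ext X Y f)"

definition type_cat :: "'v set set \<Rightarrow> ('v set, 'v \<Rightarrow> 'v) cat" where
  "type_cat Ty = \<lparr>
     Obj = Ty,
     Hom = (\<lambda>A B. A \<rightarrow>\<^sub>E B),
     Idt = (\<lambda>A. \<lambda>a\<in>A. a),
     Comp = (\<lambda>A B C g f. compose A g f)\<rparr>"

lemma category_type_cat: "category (type_cat Ty)"
  by unfold_locales
    (auto simp: type_cat_def PiE_def compose_def fun_eq_iff extensional_def Pi_iff restrict_def)

definition fam_hom :: "'v set \<Rightarrow> ('v \<Rightarrow> 'v set) \<Rightarrow> ('v \<Rightarrow> 'v set) \<Rightarrow> ('v \<Rightarrow> 'v \<Rightarrow> 'v) set" where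
  "fam_hom A P Q = (\<Pi>\<^sub>E a\<in>A. P a \<rightarrow>\<^sub>E Q a)"

definition fam_id :: "'v set \<Rightarrow> ('v \<Rightarrow> 'v set) \<Rightarrow> 'v \<Rightarrow> 'v \<Rightarrow> 'v" where
  "fam_id A P = (\<lambda>a\<in>A. \<lambda>x\<in>P a. x)"

text \<open>In \<open>fam_comp A P h' h\<close>, the family \<open>P\<close> is the domain of \<open>h\<close>.\<close>

definition fam_comp ::
    "'v set \<Rightarrow> ('v \<Rightarrow> 'v set) \<Rightarrow> ('v \<Rightarrow> 'v \<Rightarrow> 'v) \<Rightarrow> ('v \<Rightarrow> 'v \<Rightarrow> 'v) \<Rightarrow> 'v \<Rightarrow> 'v \<Rightarrow> 'v" where
  "fam_comp A P h' h = (\<lambda>a\<in>A. compose (P a) (h' a) (h a))"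

type_synonym 'v container = "'v set \<times> ('v \<Rightarrow> 'v set)"
type_synonym 'v cont_mor = "('v \<Rightarrow> 'v) \<times> ('v \<Rightarrow> 'v \<Rightarrow> 'v)"

text \<open>
  In \<open>cont_hom\<close> and \<open>cont_comp\<close>, \<open>compose A Q f\<close> is the reindexed family
  \<open>Q \<circ> f\<close> on \<open>A\<close>, and \<open>compose A l f\<close> is \<open>\<lambda>{a}. l {f a}\<close>.
\<close>

fun cont_hom :: "'v container \<Rightarrow> 'v container \<Rightarrow> 'v cont_mor set" where
  "cont_hom (A, P) (B, Q) = {(f, g). f \<in> A \<rightarrow>\<^sub>E B \<and> g \<in> fam_hom A (compose A Q f) P}"

fun cont_id :: "'v container \<Rightarrow> 'v cont_mor" where
  "cont_id (A, P) = (\<lambda>a\<in>A. a, fam_id A P)"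

fun cont_comp ::
    "'v container \<Rightarrow> 'v container \<Rightarrow> 'v container \<Rightarrow> 'v cont_mor \<Rightarrow> 'v cont_mor \<Rightarrow> 'v cont_mor" where
  "cont_comp (A, P) (B, Q) (C, R) (k, l) (f, g) =
     (compose A k f, fam_comp A (compose A R (compose A k f)) g (compose A l f))"

definition cont_cat :: "'v set set \<Rightarrow> 'v set set \<Rightarrow> ('v container, 'v cont_mor) cat" where
  "cont_cat Ty U = \<lparr>
     Obj = {(A, P). A \<in> Ty \<and> P \<in> A \<rightarrow>\<^sub>E U},
     Hom = cont_hom,
     Idt = cont_id,
     Comp = cont_comp\<rparr>"

text \<open>
  \<open>M\<close>, \<open>eta\<close>, \<open>ext\<close> are the data of the monad on \<open>type_cat Ty\<close>;
  \<open>star A P\<close> is \<open>P\<^sup>\<star>\<close>, \<open>act A P Q h\<close> is \<open>[h]\<^sup>\<star>\<close>,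
  \<open>i A P\<close> and \<open>j A B Q f\<close> are the two witnesses.
  The equations hold up to the equalities of types given by the monad laws, which are
  equalities of sets here, so no transport is needed.
\<close>

locale weak_mendler_algebra =
  fixes Ty :: "'v set set"
    and U :: "'v set set"
    and M :: "'v set \<Rightarrow> 'v set"
    and eta :: "'v set \<Rightarrow> 'v \<Rightarrow> 'v"
    and ext :: "'v set \<Rightarrow> 'v set \<Rightarrow> ('v \<Rightarrow> 'v) \<Rightarrow> 'v \<Rightarrow> 'v"
    and star :: "'v set \<Rightarrow> ('v \<Rightarrow> 'v set) \<Rightarrow> 'v \<Rightarrow> 'v set"
    and act :: "'v set \<Rightarrow> ('v \<Rightarrow> 'v set) \<Rightarrow> ('v \<Rightarrow> 'v set) \<Rightarrow> ('v \<Rightarrow> 'v \<Rightarrow> 'v) \<Rightarrow> 'v \<Rightarrow> 'v \<Rightarrow> 'v"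
    and i :: "'v set \<Rightarrow> ('v \<Rightarrow> 'v set) \<Rightarrow> 'v \<Rightarrow> 'v \<Rightarrow> 'v"
    and j :: "'v set \<Rightarrow> 'v set \<Rightarrow> ('v \<Rightarrow> 'v set) \<Rightarrow> ('v \<Rightarrow> 'v) \<Rightarrow> 'v \<Rightarrow> 'v \<Rightarrow> 'v"
  assumes star_fam: "\<lbrakk>A \<in> Ty; P \<in> A \<rightarrow>\<^sub>E U\<rbrakk> \<Longrightarrow> star A P \<in> M A \<rightarrow>\<^sub>E U"
    and act_hom: "\<lbrakk>A \<in> Ty; P \<in> A \<rightarrow>\<^sub>E U; Q \<in> A \<rightarrow>\<^sub>E U; h \<in> fam_hom A P Q\<rbrakk>
      \<Longrightarrow> act A P Q h \<in> fam_hom (M A) (star A P) (star A Q)"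
    and i_hom: "\<lbrakk>A \<in> Ty; P \<in> A \<rightarrow>\<^sub>E U\<rbrakk>
      \<Longrightarrow> i A P \<in> fam_hom A (compose A (star A P) (eta A)) P"
    and j_hom: "\<lbrakk>A \<in> Ty; B \<in> Ty; Q \<in> B \<rightarrow>\<^sub>E U; f \<in> A \<rightarrow>\<^sub>E M B\<rbrakk>
      \<Longrightarrow> j A B Q f \<in> fam_hom (M A)
            (compose (M A) (star B Q) (ext A B f)) (star A (compose A (star B Q) f))"
    and act_id: "\<lbrakk>A \<in> Ty; P \<in> A \<rightarrow>\<^sub>E U\<rbrakk>
      \<Longrightarrow> act A P P (fam_id A P) = fam_id (M A) (star A P)"
    and act_comp: "\<lbrakk>A \<in> Ty; P \<in> A \<rightarrow>\<^sub>E U; P' \<in> A \<rightarrow>\<^sub>E U; P'' \<in> A \<rightarrow>\<^sub>E U;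
        h \<in> fam_hom A P P'; h' \<in> fam_hom A P' P''\<rbrakk>
      \<Longrightarrow> act A P P'' (fam_comp A P h' h)
          = fam_comp (M A) (star A P) (act A P' P'' h') (act A P P' h)"
    and i_nat: "\<lbrakk>A \<in> Ty; P \<in> A \<rightarrow>\<^sub>E U; P' \<in> A \<rightarrow>\<^sub>E U; h \<in> fam_hom A P P'; a \<in> A\<rbrakk>
      \<Longrightarrow> compose (star A P (eta A a)) (h a) (i A P a)
          = compose (star A P (eta A a)) (i A P' a) (act A P P' h (eta A a))"
    and j_nat: "\<lbrakk>A \<in> Ty; B \<in> Ty; Q \<in> B \<rightarrow>\<^sub>E U; Q' \<in> B \<rightarrow>\<^sub>E U; k \<in> fam_hom B Q Q';
        f \<in> A \<rightarrow>\<^sub>E M B; m \<in> M A\<rbrakk>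
      \<Longrightarrow> compose (star B Q (ext A B f m))
            (act A (compose A (star B Q) f) (compose A (star B Q') f)
               (\<lambda>a\<in>A. act B Q Q' k (f a)) m)
            (j A B Q f m)
          = compose (star B Q (ext A B f m)) (j A B Q' f m) (act B Q Q' k (ext A B f m))"
    and i_j: "\<lbrakk>A \<in> Ty; B \<in> Ty; Q \<in> B \<rightarrow>\<^sub>E U; f \<in> A \<rightarrow>\<^sub>E M B; a \<in> A\<rbrakk>
      \<Longrightarrow> compose (star B Q (ext A B f (eta A a)))
            (i A (compose A (star B Q) f) a) (j A B Q f (eta A a))
          = (\<lambda>x\<in>star B Q (f a). x)"
    and act_i_j: "\<lbrakk>A \<in> Ty; P \<in> A \<rightarrow>\<^sub>E U; m \<in> M A\<rbrakk>
      \<Longrightarrow> compose (star A P (ext A A (eta A) m))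
            (act A (compose A (star A P) (eta A)) P (i A P) m) (j A A P (eta A) m)
          = (\<lambda>x\<in>star A P m. x)"
    and j_j: "\<lbrakk>A \<in> Ty; B \<in> Ty; C \<in> Ty; R \<in> C \<rightarrow>\<^sub>E U; f \<in> A \<rightarrow>\<^sub>E M B; g \<in> B \<rightarrow>\<^sub>E M C; m \<in> M A\<rbrakk>
      \<Longrightarrow> compose (star C R (ext B C g (ext A B f m)))
            (j A B (compose B (star C R) g) f m) (j B C R g (ext A B f m))
          = compose (star C R (ext B C g (ext A B f m)))
            (act A (compose A (star C R) (compose A (ext B C g) f))
               (compose A (star B (compose B (star C R) g)) f)
               (\<lambda>a\<in>A. j B C R g (f a)) m)
            (j A C R (compose A (ext B C g) f) m)"

fun cont_T :: "('v set \<Rightarrow> 'v set) \<Rightarrow> ('v set \<Rightarrow> ('v \<Rightarrow> 'v set) \<Rightarrow> 'v \<Rightarrow> 'v set)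
    \<Rightarrow> 'v container \<Rightarrow> 'v container" where
  "cont_T M star (A, P) = (M A, star A P)"

fun cont_eta :: "('v set \<Rightarrow> 'v \<Rightarrow> 'v) \<Rightarrow> ('v set \<Rightarrow> ('v \<Rightarrow> 'v set) \<Rightarrow> 'v \<Rightarrow> 'v \<Rightarrow> 'v)
    \<Rightarrow> 'v container \<Rightarrow> 'v cont_mor" where
  "cont_eta eta i (A, P) = (eta A, i A P)"

fun cont_ext :: "('v set \<Rightarrow> 'v set)
    \<Rightarrow> ('v set \<Rightarrow> 'v set \<Rightarrow> ('v \<Rightarrow> 'v) \<Rightarrow> 'v \<Rightarrow> 'v)
    \<Rightarrow> ('v set \<Rightarrow> ('v \<Rightarrow> 'v set) \<Rightarrow> 'v \<Rightarrow> 'v set)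
    \<Rightarrow> ('v set \<Rightarrow> ('v \<Rightarrow> 'v set) \<Rightarrow> ('v \<Rightarrow> 'v set) \<Rightarrow> ('v \<Rightarrow> 'v \<Rightarrow> 'v) \<Rightarrow> 'v \<Rightarrow> 'v \<Rightarrow> 'v)
    \<Rightarrow> ('v set \<Rightarrow> 'v set \<Rightarrow> ('v \<Rightarrow> 'v set) \<Rightarrow> ('v \<Rightarrow> 'v) \<Rightarrow> 'v \<Rightarrow> 'v \<Rightarrow> 'v)
    \<Rightarrow> 'v container \<Rightarrow> 'v container \<Rightarrow> 'v cont_mor \<Rightarrow> 'v cont_mor" where
  "cont_ext M ext star act j (A, P) (B, Q) (f, g) =
     (ext A B f,
      fam_comp (M A) (compose (M A) (star B Q) (ext A B f))
        (act A (compose A (star B Q) f) P g) (j A B Q f))"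

end

theory Submission
  imports Defs
begin

text \<open>
  The first components of the monad laws on containers are the monad laws of \<open>M\<close>.  On second
  components, the law \<open>\<eta>\<^sup>\<dagger> = id\<close> is the second coherence law, and
  \<open>f\<^sup>\<dagger> \<circ> \<eta> = f\<close> follows from naturality of \<open>i\<close> and the first
  coherence law.  For associativity, functoriality splits the extension of the composite into
  \<open>[g]\<^sup>\<star> \<circ> [[l]\<^sup>\<star>]\<^sup>\<star> \<circ> [j]\<^sup>\<star> \<circ> j\<close>; the third coherence law turns \<open>[j]\<^sup>\<star> \<circ> j\<close> into
  \<open>j \<circ> j\<close>, and naturality of \<open>j\<close> moves \<open>[[l]\<^sup>\<star>]\<^sup>\<star>\<close> past the outer \<open>j\<close>.
\<close>

section \<open>Extensional functions, family maps and reindexing\<close>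

lemma compose_PiE: "\<lbrakk>f \<in> A \<rightarrow>\<^sub>E B; g \<in> B \<rightarrow>\<^sub>E C\<rbrakk> \<Longrightarrow> compose A g f \<in> A \<rightarrow>\<^sub>E C"
  by (auto simp: compose_def)

text \<open>The restriction to \<open>B\<close> inside the composite is invisible because
  \<open>f\<close> maps \<open>A\<close> into \<open>B\<close>. Every rebracketing below therefore
  has to supply a typing of the innermost map.\<close>

lemma compose_assoc_PiE:
  "f \<in> A \<rightarrow>\<^sub>E B \<Longrightarrow> compose A (compose B h g) f = compose A h (compose A g f)"
  by (auto simp: compose_def fun_eq_iff)

lemma compose_restrict_id: "h \<in> extensional A \<Longrightarrow> compose A h (\<lambda>a\<in>A. a) = h"
  by (auto simp: compose_def fun_eq_iff extensional_def)

lemma restrict_id_compose: "h \<in> A \<rightarrow>\<^sub>E B \<Longrightarrow> compose A (\<lambda>b\<in>B. b) h = h"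
  by (auto simp: compose_def fun_eq_iff extensional_def PiE_iff)

lemma fam_hom_extensional: "h \<in> fam_hom A P Q \<Longrightarrow> h \<in> extensional A"
  by (simp add: fam_hom_def PiE_iff)

lemma fam_hom_app: "\<lbrakk>h \<in> fam_hom A P Q; a \<in> A\<rbrakk> \<Longrightarrow> h a \<in> P a \<rightarrow>\<^sub>E Q a"
  by (auto simp: fam_hom_def)

lemma fam_id_hom: "fam_id A P \<in> fam_hom A P P"
  by (auto simp: fam_id_def fam_hom_def)

lemma fam_comp_hom:
  assumes h: "h \<in> fam_hom A P Q" and k: "k \<in> fam_hom A Q R"
  shows "fam_comp A P k h \<in> fam_hom A P R"
  unfolding fam_comp_def
  by (subst fam_hom_def) (simp add: compose_PiE[OF fam_hom_app[OF h] fam_hom_app[OF k]])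

lemma fam_comp_assoc:
  "h \<in> fam_hom A P Q \<Longrightarrow>
    fam_comp A P (fam_comp A Q l k) h = fam_comp A P l (fam_comp A P k h)"
  unfolding fam_comp_def
  by (intro restrict_ext) (simp add: compose_assoc_PiE[OF fam_hom_app])

lemma fam_comp_id_left: "h \<in> fam_hom A P Q \<Longrightarrow> fam_comp A P (fam_id A Q) h = h"
  unfolding fam_comp_def fam_id_def
  by (rule extensionalityI[of _ A])
    (auto simp: fam_hom_extensional restrict_id_compose[OF fam_hom_app])

lemma fam_comp_id_right: "h \<in> fam_hom A P Q \<Longrightarrow> fam_comp A P h (fam_id A P) = h"
  unfolding fam_comp_def fam_id_def
  by (rule extensionalityI[of _ A])
    (auto simp: fam_hom_extensional intro!: compose_restrict_id dest!: fam_hom_app simp: PiE_iff)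

text \<open>Together with the next two lemmas: reindexing along \<open>f\<close> is a functor from
  families on \<open>B\<close> to families on \<open>A\<close>. Note that
  \<open>compose A h f\<close> changes only the index; the fibre maps of \<open>h\<close> stay as
  they are.\<close>

lemma reindex_fam_hom:
  "\<lbrakk>h \<in> fam_hom B P Q; f \<in> A \<rightarrow>\<^sub>E B\<rbrakk>
    \<Longrightarrow> compose A h f \<in> fam_hom A (compose A P f) (compose A Q f)"
  unfolding fam_hom_def by (force simp: compose_def PiE_iff)

lemma reindex_fam_comp:
  "f \<in> A \<rightarrow>\<^sub>E B \<Longrightarrow>
    compose A (fam_comp B P k h) f = fam_comp A (compose A P f) (compose A k f) (compose A h f)"
  by (auto simp: fam_comp_def compose_def fun_eq_iff)

lemma reindex_fam_id:
  "f \<in> A \<rightarrow>\<^sub>E B \<Longrightarrow> compose A (fam_id B P) f = fam_id A (compose A P f)"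
  by (auto simp: fam_id_def compose_def fun_eq_iff)

section \<open>The category of containers\<close>

lemma category_cont_cat: "category (cont_cat Ty U)"
proof unfold_locales
  show "Idt (cont_cat Ty U) X \<in> Hom (cont_cat Ty U) X X" if "X \<in> Obj (cont_cat Ty U)" for X
    using that by (cases X) (simp add: cont_cat_def compose_restrict_id fam_id_hom PiE_iff)
next
  fix X Y Z f g
  assume *: "X \<in> Obj (cont_cat Ty U)" "Y \<in> Obj (cont_cat Ty U)" "Z \<in> Obj (cont_cat Ty U)"
    "f \<in> Hom (cont_cat Ty U) X Y" "g \<in> Hom (cont_cat Ty U) Y Z"
  obtain A P B Q C R where obj: "X = (A, P)" "Y = (B, Q)" "Z = (C, R)"
    by (metis surj_pair)
  obtain f1 f2 g1 g2 where mor: "f = (f1, f2)" "g = (g1, g2)"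
    by (metis surj_pair)
  have f: "f1 \<in> A \<rightarrow>\<^sub>E B" "f2 \<in> fam_hom A (compose A Q f1) P"
    and g: "g1 \<in> B \<rightarrow>\<^sub>E C" "g2 \<in> fam_hom B (compose B R g1) Q"
    using * unfolding obj mor by (auto simp: cont_cat_def)
  \<comment> \<open>The fibre maps run backwards, so \<open>g2\<close> is pulled back along
    \<open>f1\<close> before \<open>f2\<close> can follow it.\<close>
  have "compose A g2 f1 \<in> fam_hom A (compose A R (compose A g1 f1)) (compose A Q f1)"
    using reindex_fam_hom[OF g(2) f(1)] by (simp add: compose_assoc_PiE[OF f(1)])
  from fam_comp_hom[OF this f(2)] show "Comp (cont_cat Ty U) X Y Z g f \<in> Hom (cont_cat Ty U) X Z"
    unfolding obj mor by (simp add: cont_cat_def compose_PiE[OF f(1) g(1)])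
next
  fix X Y f
  assume *: "X \<in> Obj (cont_cat Ty U)" "Y \<in> Obj (cont_cat Ty U)" "f \<in> Hom (cont_cat Ty U) X Y"
  obtain A P B Q f1 f2 where eqs: "X = (A, P)" "Y = (B, Q)" "f = (f1, f2)"
    by (metis surj_pair)
  have f: "f1 \<in> A \<rightarrow>\<^sub>E B" "f2 \<in> fam_hom A (compose A Q f1) P"
    using * unfolding eqs by (auto simp: cont_cat_def)
  have "f1 \<in> extensional A"
    using f(1) by (simp add: PiE_iff)
  \<comment> \<open>Contravariance in the fibres swaps the sides: the right unit law for containers
    uses the left unit law for family maps, and conversely.\<close>
  then show "Comp (cont_cat Ty U) X X Y f (Idt (cont_cat Ty U) X) = f"
    unfolding eqs
    by (simp add: cont_cat_def compose_restrict_id fam_hom_extensional[OF f(2)]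
        fam_comp_id_left[OF f(2)])
  show "Comp (cont_cat Ty U) X Y Y (Idt (cont_cat Ty U) Y) f = f"
    unfolding eqs
    by (simp add: cont_cat_def restrict_id_compose[OF f(1)] reindex_fam_id[OF f(1)]
        fam_comp_id_right[OF f(2)])
next
  fix W X Y Z f g h
  assume *: "W \<in> Obj (cont_cat Ty U)" "X \<in> Obj (cont_cat Ty U)"
    "Y \<in> Obj (cont_cat Ty U)" "Z \<in> Obj (cont_cat Ty U)"
    "f \<in> Hom (cont_cat Ty U) W X" "g \<in> Hom (cont_cat Ty U) X Y" "h \<in> Hom (cont_cat Ty U) Y Z"
  obtain A P B Q C R D S where obj: "W = (A, P)" "X = (B, Q)" "Y = (C, R)" "Z = (D, S)"
    by (metis surj_pair)
  obtain f1 f2 g1 g2 h1 h2 where mor: "f = (f1, f2)" "g = (g1, g2)" "h = (h1, h2)"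
    by (metis surj_pair)
  have f: "f1 \<in> A \<rightarrow>\<^sub>E B" and g: "g1 \<in> B \<rightarrow>\<^sub>E C"
    and h2: "h2 \<in> fam_hom C (compose C S h1) R"
    using * unfolding obj mor by (auto simp: cont_cat_def)
  have gf: "compose A g1 f1 \<in> A \<rightarrow>\<^sub>E C"
    using f g by (rule compose_PiE)
  \<comment> \<open>The pulled-back \<open>h2\<close> is the innermost fibre map of the triple
    composite, so its typing is the side condition of \<open>fam_comp_assoc\<close>.\<close>
  have "compose A h2 (compose A g1 f1)
      \<in> fam_hom A (compose A S (compose A h1 (compose A g1 f1))) (compose A R (compose A g1 f1))"
    using reindex_fam_hom[OF h2 gf] by (simp add: compose_assoc_PiE[OF gf])
  then show "Comp (cont_cat Ty U) W Y Z h (Comp (cont_cat Ty U) W X Y g f)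
      = Comp (cont_cat Ty U) W X Z (Comp (cont_cat Ty U) X Y Z h g) f"
    unfolding obj mor
    by (simp add: cont_cat_def compose_assoc_PiE[OF f] compose_assoc_PiE[OF g]
        reindex_fam_comp[OF f] fam_comp_assoc)
qed

section \<open>The monad and algebra laws in the form of functions and whole families\<close>

locale weak_mendler_monad =
  kleisli_triple "type_cat Ty" M eta ext + weak_mendler_algebra Ty U M eta ext star act i j
  for Ty U :: "'v set set" and M eta ext star act i j
begin

lemma M_Ty: "A \<in> Ty \<Longrightarrow> M A \<in> Ty"
  using T_Obj[of A] by (simp add: type_cat_def)

lemma eta_PiE: "A \<in> Ty \<Longrightarrow> eta A \<in> A \<rightarrow>\<^sub>E M A"
  using eta_Hom[of A] by (simp add: type_cat_def)

lemma ext_PiE: "\<lbrakk>A \<in> Ty; B \<in> Ty; f \<in> A \<rightarrow>\<^sub>E M B\<rbrakk> \<Longrightarrow> ext A B f \<in> M A \<rightarrow>\<^sub>E M B"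
  using ext_Hom[of A B f] by (simp add: type_cat_def)

lemma ext_eta_id: "A \<in> Ty \<Longrightarrow> ext A A (eta A) = (\<lambda>m\<in>M A. m)"
  using ext_eta[of A] by (simp add: type_cat_def)

lemma compose_ext_eta: "\<lbrakk>A \<in> Ty; B \<in> Ty; f \<in> A \<rightarrow>\<^sub>E M B\<rbrakk> \<Longrightarrow> compose A (ext A B f) (eta A) = f"
  using ext_comp_eta[of A B f] by (simp add: type_cat_def)

lemma ext_compose_ext:
  "\<lbrakk>A \<in> Ty; B \<in> Ty; C \<in> Ty; f \<in> A \<rightarrow>\<^sub>E M B; g \<in> B \<rightarrow>\<^sub>E M C\<rbrakk>
    \<Longrightarrow> ext A C (compose A (ext B C g) f) = compose (M A) (ext B C g) (ext A B f)"
  using ext_ext[of A B C f g] by (simp add: type_cat_def)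

lemma star_reindex_fam:
  "\<lbrakk>B \<in> Ty; Q \<in> B \<rightarrow>\<^sub>E U; f \<in> A \<rightarrow>\<^sub>E M B\<rbrakk> \<Longrightarrow> compose A (star B Q) f \<in> A \<rightarrow>\<^sub>E U"
  by (rule compose_PiE[OF _ star_fam])

text \<open>Here and in the next four lemmas the pointwise laws become equations between family
  maps, so that the main calculations can be done with \<open>fam_comp\<close> alone, without
  indices.\<close>

lemma fam_i_nat:
  assumes "A \<in> Ty" "P \<in> A \<rightarrow>\<^sub>E U" "P' \<in> A \<rightarrow>\<^sub>E U" "h \<in> fam_hom A P P'"
  shows "fam_comp A (compose A (star A P) (eta A)) (i A P') (compose A (act A P P' h) (eta A))
      = fam_comp A (compose A (star A P) (eta A)) h (i A P)"
  using i_nat[OF assms] by (auto simp: fam_comp_def compose_eq intro!: restrict_ext)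

lemma fam_j_nat:
  assumes "A \<in> Ty" "B \<in> Ty" "Q \<in> B \<rightarrow>\<^sub>E U" "Q' \<in> B \<rightarrow>\<^sub>E U" "k \<in> fam_hom B Q Q'"
    and "f \<in> A \<rightarrow>\<^sub>E M B"
  shows "fam_comp (M A) (compose (M A) (star B Q) (ext A B f))
        (act A (compose A (star B Q) f) (compose A (star B Q') f) (compose A (act B Q Q' k) f))
        (j A B Q f)
      = fam_comp (M A) (compose (M A) (star B Q) (ext A B f))
        (j A B Q' f) (compose (M A) (act B Q Q' k) (ext A B f))"
  \<comment> \<open>The law has an explicit abstraction under \<open>act\<close>. Unfolding
    \<open>compose\<close> at this one instance produces it and leaves the reindexed families
    folded.\<close>
  using j_nat[OF assms]
  by (auto simp: fam_comp_def compose_eq compose_def[of A "act B Q Q' k"] intro!: restrict_ext)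

lemma fam_i_j:
  assumes A: "A \<in> Ty" and B: "B \<in> Ty" and Q: "Q \<in> B \<rightarrow>\<^sub>E U" and f: "f \<in> A \<rightarrow>\<^sub>E M B"
  shows "fam_comp A (compose A (star B Q) f)
        (i A (compose A (star B Q) f)) (compose A (j A B Q f) (eta A))
      = fam_id A (compose A (star B Q) f)"
proof -
  \<comment> \<open>The pointwise law composes on the fibre over \<open>ext A B f (eta A a)\<close>;
    the unit law of \<open>M\<close> identifies it with the fibre over \<open>f a\<close>.\<close>
  have "ext A B f (eta A a) = f a" if "a \<in> A" for a
    using that compose_ext_eta[OF A B f] by (metis compose_eq)
  then show ?thesis
    using i_j[OF assms] by (auto simp: fam_comp_def fam_id_def compose_eq intro!: restrict_ext)
qed

lemma fam_act_i_j:
  assumes A: "A \<in> Ty" and P: "P \<in> A \<rightarrow>\<^sub>E U"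
  shows "fam_comp (M A) (star A P)
        (act A (compose A (star A P) (eta A)) P (i A P)) (j A A P (eta A))
      = fam_id (M A) (star A P)"
  using act_i_j[OF assms]
  by (auto simp: fam_comp_def fam_id_def ext_eta_id[OF A] intro!: restrict_ext)

lemma fam_j_j:
  assumes "A \<in> Ty" "B \<in> Ty" "C \<in> Ty" "R \<in> C \<rightarrow>\<^sub>E U" "f \<in> A \<rightarrow>\<^sub>E M B" "g \<in> B \<rightarrow>\<^sub>E M C"
  shows "fam_comp (M A) (compose (M A) (star C R) (compose (M A) (ext B C g) (ext A B f)))
        (j A B (compose B (star C R) g) f) (compose (M A) (j B C R g) (ext A B f))
      = fam_comp (M A) (compose (M A) (star C R) (compose (M A) (ext B C g) (ext A B f)))
        (act A (compose A (star C R) (compose A (ext B C g) f))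
          (compose A (star B (compose B (star C R) g)) f) (compose A (j B C R g) f))
        (j A C R (compose A (ext B C g) f))"
  using j_j[OF assms]
  by (auto simp: fam_comp_def compose_eq compose_def[of A "j B C R g"] intro!: restrict_ext)

section \<open>Second components of the container monad laws\<close>

lemma cont_ext_snd_hom:
  assumes "A \<in> Ty" "B \<in> Ty" "P \<in> A \<rightarrow>\<^sub>E U" "Q \<in> B \<rightarrow>\<^sub>E U" "f \<in> A \<rightarrow>\<^sub>E M B"
    and "g \<in> fam_hom A (compose A (star B Q) f) P"
  shows "fam_comp (M A) (compose (M A) (star B Q) (ext A B f))
        (act A (compose A (star B Q) f) P g) (j A B Q f)
      \<in> fam_hom (M A) (compose (M A) (star B Q) (ext A B f)) (star A P)"
  using assms by (intro fam_comp_hom[OF j_hom act_hom] star_reindex_fam)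

text \<open>Along \<open>eta\<close>, naturality of \<open>i\<close> replaces the action of
  \<open>g\<close> by \<open>g\<close> itself, which leaves \<open>i\<close> directly after
  \<open>j\<close>, and these two cancel.\<close>

lemma cont_ext_snd_eta:
  assumes A: "A \<in> Ty" and B: "B \<in> Ty" and P: "P \<in> A \<rightarrow>\<^sub>E U" and Q: "Q \<in> B \<rightarrow>\<^sub>E U"
    and f: "f \<in> A \<rightarrow>\<^sub>E M B" and g: "g \<in> fam_hom A (compose A (star B Q) f) P"
  shows "fam_comp A (compose A (star B Q) f) (i A P)
      (compose A (fam_comp (M A) (compose (M A) (star B Q) (ext A B f))
        (act A (compose A (star B Q) f) P g) (j A B Q f)) (eta A)) = g"
proof -
  define Qf where "Qf = compose A (star B Q) f"
  note eta = eta_PiE[OF A]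
  have Qf: "Qf \<in> A \<rightarrow>\<^sub>E U"
    unfolding Qf_def by (rule star_reindex_fam[OF B Q f])
  \<comment> \<open>By the unit law of \<open>M\<close>, the source of \<open>j\<close> pulled back
    along \<open>eta\<close> is \<open>Qf\<close> again.\<close>
  have Qf_eq: "compose A (compose (M A) (star B Q) (ext A B f)) (eta A) = Qf"
    by (simp add: Qf_def compose_assoc_PiE[OF eta] compose_ext_eta[OF A B f])
  have j: "compose A (j A B Q f) (eta A) \<in> fam_hom A Qf (compose A (star A Qf) (eta A))"
    using reindex_fam_hom[OF j_hom[OF A B Q f] eta] by (simp add: Qf_eq Qf_def[symmetric])
  have act: "compose A (act A Qf P g) (eta A)
      \<in> fam_hom A (compose A (star A Qf) (eta A)) (compose A (star A P) (eta A))"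
    by (rule reindex_fam_hom[OF act_hom[OF A Qf P] eta]) (use g Qf_def in simp)
  have "fam_comp A Qf (i A P)
        (fam_comp A Qf (compose A (act A Qf P g) (eta A)) (compose A (j A B Q f) (eta A)))
      = fam_comp A Qf
        (fam_comp A (compose A (star A Qf) (eta A)) (i A P) (compose A (act A Qf P g) (eta A)))
        (compose A (j A B Q f) (eta A))"
    by (rule fam_comp_assoc[OF j, symmetric])
  also have "\<dots> = fam_comp A Qf
        (fam_comp A (compose A (star A Qf) (eta A)) g (i A Qf)) (compose A (j A B Q f) (eta A))"
    using fam_i_nat[OF A Qf P] g by (simp add: Qf_def)
  also have "\<dots> = fam_comp A Qf g (fam_comp A Qf (i A Qf) (compose A (j A B Q f) (eta A)))"
    by (rule fam_comp_assoc[OF j])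
  also have "\<dots> = g"
    using fam_comp_id_right[OF g] fam_i_j[OF A B Q f] by (simp add: Qf_def)
  finally show ?thesis
    by (simp add: reindex_fam_comp[OF eta] Qf_eq Qf_def[symmetric])
qed

text \<open>The associativity law for \<open>(f, g)\<close> into \<open>T (B, Q)\<close> and
  \<open>(k, l)\<close> into \<open>T (C, R)\<close>: \<open>g'\<close> and \<open>l'\<close> are
  the second components of their extensions, and \<open>kf\<close> is the first component of the
  composite to be extended.\<close>

lemma cont_ext_snd_ext:
  assumes A: "A \<in> Ty" and B: "B \<in> Ty" and C: "C \<in> Ty"
    and P: "P \<in> A \<rightarrow>\<^sub>E U" and Q: "Q \<in> B \<rightarrow>\<^sub>E U" and R: "R \<in> C \<rightarrow>\<^sub>E U"
    and f: "f \<in> A \<rightarrow>\<^sub>E M B" and g: "g \<in> fam_hom A (compose A (star B Q) f) P"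
    and k: "k \<in> B \<rightarrow>\<^sub>E M C" and l: "l \<in> fam_hom B (compose B (star C R) k) Q"
  defines "kf \<equiv> compose A (ext B C k) f"
    and "l' \<equiv> fam_comp (M B) (compose (M B) (star C R) (ext B C k))
        (act B (compose B (star C R) k) Q l) (j B C R k)"
    and "g' \<equiv> fam_comp (M A) (compose (M A) (star B Q) (ext A B f))
        (act A (compose A (star B Q) f) P g) (j A B Q f)"
  shows "fam_comp (M A) (compose (M A) (star C R) (ext A C kf))
        (act A (compose A (star C R) kf) P
          (fam_comp A (compose A (star C R) kf) g (compose A l' f)))
        (j A C R kf)
      = fam_comp (M A) (compose (M A) (star C R) (ext A C kf)) g' (compose (M A) l' (ext A B f))"
proof -
  define Qf where "Qf = compose A (star B Q) f"
  define Rk where "Rk = compose B (star C R) k"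
  define Rkf where "Rkf = compose A (star C R) kf"
  define RkB where "RkB = compose A (star B Rk) f"
  define D where "D = compose (M A) (star C R) (ext A C kf)"
  define lf where "lf = compose A (act B Rk Q l) f"
  define jf where "jf = compose A (j B C R k) f"
  define f' where "f' = ext A B f"
  have f': "f' \<in> M A \<rightarrow>\<^sub>E M B"
    unfolding f'_def by (rule ext_PiE[OF A B f])
  have k': "ext B C k \<in> M B \<rightarrow>\<^sub>E M C"
    by (rule ext_PiE[OF B C k])
  have kf: "kf \<in> A \<rightarrow>\<^sub>E M C"
    unfolding kf_def by (rule compose_PiE[OF f k'])
  have ext_kf: "ext A C kf = compose (M A) (ext B C k) f'"
    unfolding kf_def f'_def by (rule ext_compose_ext[OF A B C f k])
  \<comment> \<open>Both sides start from the same family \<open>D\<close> by the associativity law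
    of \<open>M\<close>. Written as a reindexing along \<open>f'\<close>, it can receive family maps
    pulled back from \<open>M B\<close>.\<close>
  have D_eq: "D = compose (M A) (compose (M B) (star C R) (ext B C k)) f'"
    by (simp add: D_def ext_kf compose_assoc_PiE[OF f'])
  have Rkf_eq: "Rkf = compose A (compose (M B) (star C R) (ext B C k)) f"
    by (simp add: Rkf_def kf_def compose_assoc_PiE[OF f])
  have Qf: "Qf \<in> A \<rightarrow>\<^sub>E U" unfolding Qf_def by (rule star_reindex_fam[OF B Q f])
  have Rk: "Rk \<in> B \<rightarrow>\<^sub>E U" unfolding Rk_def by (rule star_reindex_fam[OF C R k])
  have Rkf: "Rkf \<in> A \<rightarrow>\<^sub>E U" unfolding Rkf_def by (rule star_reindex_fam[OF C R kf])
  have RkB: "RkB \<in> A \<rightarrow>\<^sub>E U" unfolding RkB_def by (rule star_reindex_fam[OF B Rk f])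
  have g: "g \<in> fam_hom A Qf P" using g by (simp add: Qf_def)
  have l: "l \<in> fam_hom B Rk Q" using l by (simp add: Rk_def)
  have act_l: "act B Rk Q l \<in> fam_hom (M B) (star B Rk) (star B Q)"
    by (rule act_hom[OF B Rk Q l])
  have j_k: "j B C R k \<in> fam_hom (M B) (compose (M B) (star C R) (ext B C k)) (star B Rk)"
    using j_hom[OF B C R k] by (simp add: Rk_def)
  have lf: "lf \<in> fam_hom A RkB Qf"
    unfolding lf_def RkB_def Qf_def by (rule reindex_fam_hom[OF act_l f])
  have jf: "jf \<in> fam_hom A Rkf RkB"
    unfolding jf_def Rkf_eq RkB_def by (rule reindex_fam_hom[OF j_k f])
  have j_kf: "j A C R kf \<in> fam_hom (M A) D (star A Rkf)"
    using j_hom[OF A C R kf] by (simp add: D_def Rkf_def)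
  have j_k_f': "compose (M A) (j B C R k) f' \<in> fam_hom (M A) D (compose (M A) (star B Rk) f')"
    unfolding D_eq by (rule reindex_fam_hom[OF j_k f'])
  have act_l_f': "compose (M A) (act B Rk Q l) f'
      \<in> fam_hom (M A) (compose (M A) (star B Rk) f') (compose (M A) (star B Q) f')"
    by (rule reindex_fam_hom[OF act_l f'])
  have l'_f': "compose (M A) l' f'
      = fam_comp (M A) D (compose (M A) (act B Rk Q l) f') (compose (M A) (j B C R k) f')"
    by (simp add: l'_def reindex_fam_comp[OF f'] D_eq Rk_def)
  have act_jf: "act A Rkf RkB jf \<in> fam_hom (M A) (star A Rkf) (star A RkB)"
    by (rule act_hom[OF A Rkf RkB jf])
  have act_lf: "act A RkB Qf lf \<in> fam_hom (M A) (star A RkB) (star A Qf)"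
    by (rule act_hom[OF A RkB Qf lf])
  \<comment> \<open>Reindexing \<open>l'\<close> along \<open>f\<close> splits it into
    \<open>jf\<close> followed by \<open>lf\<close>; functoriality of \<open>act\<close> then
    separates three factors.\<close>
  have "act A Rkf P (fam_comp A Rkf g (compose A l' f))
      = act A Rkf P (fam_comp A Rkf g (fam_comp A Rkf lf jf))"
    by (simp add: l'_def reindex_fam_comp[OF f] Rkf_eq lf_def jf_def Rk_def)
  also have "\<dots> = fam_comp (M A) (star A Rkf) (act A Qf P g)
        (fam_comp (M A) (star A Rkf) (act A RkB Qf lf) (act A Rkf RkB jf))"
    by (simp add: act_comp[OF A Rkf Qf P fam_comp_hom[OF jf lf] g]
        act_comp[OF A Rkf RkB Qf jf lf])
  finally have "fam_comp (M A) D (act A Rkf P (fam_comp A Rkf g (compose A l' f))) (j A C R kf)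
      = fam_comp (M A) D (act A Qf P g) (fam_comp (M A) D (act A RkB Qf lf)
          (fam_comp (M A) D (act A Rkf RkB jf) (j A C R kf)))"
    by (simp add: fam_comp_assoc[OF j_kf])
  \<comment> \<open>Third coherence law: \<open>j\<close> at the composite \<open>kf\<close> is
    traded for two successive uses of \<open>j\<close>, through the intermediate family
    \<open>Rk\<close>.\<close>
  also have "fam_comp (M A) D (act A Rkf RkB jf) (j A C R kf)
      = fam_comp (M A) D (j A B Rk f) (compose (M A) (j B C R k) f')"
    using fam_j_j[OF A B C R f k]
    by (simp add: D_def ext_kf[unfolded kf_def] kf_def f'_def Rkf_def RkB_def Rk_def jf_def)
  \<comment> \<open>Rebracketing brings \<open>act\<close> of \<open>lf\<close> next to
    \<open>j\<close> at \<open>Rk\<close>, which exposes the naturality square of \<open>j\<close>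
    for \<open>act_l\<close>'s underlying map \<open>l\<close>.\<close>
  also have "fam_comp (M A) D (act A RkB Qf lf) \<dots>
      = fam_comp (M A) D (fam_comp (M A) (compose (M A) (star B Rk) f')
          (act A RkB Qf lf) (j A B Rk f)) (compose (M A) (j B C R k) f')"
    by (rule fam_comp_assoc[OF j_k_f', symmetric])
  also have "fam_comp (M A) (compose (M A) (star B Rk) f') (act A RkB Qf lf) (j A B Rk f)
      = fam_comp (M A) (compose (M A) (star B Rk) f') (j A B Q f)
          (compose (M A) (act B Rk Q l) f')"
    using fam_j_nat[OF A B Rk Q l f] by (simp add: f'_def RkB_def Qf_def lf_def)
  also have "fam_comp (M A) D \<dots> (compose (M A) (j B C R k) f')
      = fam_comp (M A) D (j A B Q f) (compose (M A) l' f')"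
    by (simp only: fam_comp_assoc[OF j_k_f'] l'_f')
  \<comment> \<open>The two outer factors are exactly \<open>g'\<close>; the typing of the
    pulled-back \<open>l'\<close> allows them to be grouped.\<close>
  also have "fam_comp (M A) D (act A Qf P g) \<dots> = fam_comp (M A) D g' (compose (M A) l' f')"
  proof -
    have "compose (M A) l' f' \<in> fam_hom (M A) D (compose (M A) (star B Q) f')"
      unfolding l'_f' by (rule fam_comp_hom[OF j_k_f' act_l_f'])
    then show ?thesis
      by (simp add: g'_def Qf_def f'_def fam_comp_assoc)
  qed
  finally show ?thesis
    by (simp add: D_def Rkf_def f'_def)
qed

section \<open>Assembly of the Kleisli triple on containers\<close>

lemma kleisli_triple_cont_cat:
  "kleisli_triple (cont_cat Ty U) (cont_T M star) (cont_eta eta i) (cont_ext M ext star act j)"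
proof (rule kleisli_triple.intro[OF category_cont_cat], unfold_locales)
  show "cont_T M star X \<in> Obj (cont_cat Ty U)" if "X \<in> Obj (cont_cat Ty U)" for X
    using that by (cases X) (simp add: cont_cat_def M_Ty star_fam)
  show "cont_eta eta i X \<in> Hom (cont_cat Ty U) X (cont_T M star X)"
    if "X \<in> Obj (cont_cat Ty U)" for X
    using that by (cases X) (simp add: cont_cat_def eta_PiE i_hom)
  show "cont_ext M ext star act j X X (cont_eta eta i X) = Idt (cont_cat Ty U) (cont_T M star X)"
    if "X \<in> Obj (cont_cat Ty U)" for X
  proof (cases X)
    case (Pair A P)
    with that have A: "A \<in> Ty" and P: "P \<in> A \<rightarrow>\<^sub>E U"
      by (auto simp: cont_cat_def)
    \<comment> \<open>Once the extended unit is the identity, the source of \<open>j\<close> is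
      \<open>star A P\<close> reindexed along it, which extensionality collapses.\<close>
    have "compose (M A) (star A P) (\<lambda>m\<in>M A. m) = star A P"
      using star_fam[OF A P] by (simp add: compose_restrict_id PiE_iff)
    then show ?thesis
      using Pair by (simp add: cont_cat_def ext_eta_id[OF A] fam_act_i_j[OF A P])
  qed
next
  fix X Y f
  assume "X \<in> Obj (cont_cat Ty U)" "Y \<in> Obj (cont_cat Ty U)"
    "f \<in> Hom (cont_cat Ty U) X (cont_T M star Y)"
  then show "cont_ext M ext star act j X Y f
      \<in> Hom (cont_cat Ty U) (cont_T M star X) (cont_T M star Y)"
    and "Comp (cont_cat Ty U) X (cont_T M star X) (cont_T M star Y)
      (cont_ext M ext star act j X Y f) (cont_eta eta i X) = f"
    by (cases X; cases Y; cases f;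
        simp add: cont_cat_def ext_PiE cont_ext_snd_hom compose_ext_eta cont_ext_snd_eta)+
next
  fix X Y Z f g
  assume "X \<in> Obj (cont_cat Ty U)" "Y \<in> Obj (cont_cat Ty U)" "Z \<in> Obj (cont_cat Ty U)"
    "f \<in> Hom (cont_cat Ty U) X (cont_T M star Y)" "g \<in> Hom (cont_cat Ty U) Y (cont_T M star Z)"
  then show "cont_ext M ext star act j X Z (Comp (cont_cat Ty U) X (cont_T M star Y)
        (cont_T M star Z) (cont_ext M ext star act j Y Z g) f)
      = Comp (cont_cat Ty U) (cont_T M star X) (cont_T M star Y) (cont_T M star Z)
        (cont_ext M ext star act j Y Z g) (cont_ext M ext star act j X Y f)"
    \<comment> \<open>The law of \<open>M\<close> is used from right to left, folding the composite
      of extensions into the extension \<open>ext A C kf\<close> in which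
      \<open>cont_ext_snd_ext\<close> is stated.\<close>
    by (cases X; cases Y; cases Z; cases f; cases g)
      (simp add: cont_cat_def cont_ext_snd_ext flip: ext_compose_ext)
qed

end

theorem theorem9:
  fixes Ty U :: "'v set set"
  assumes "U \<subseteq> Ty"
    and "kleisli_triple (type_cat Ty) M eta ext"
    and "weak_mendler_algebra Ty U M eta ext star act i j"
  shows "kleisli_triple (cont_cat Ty U)
    (cont_T M star) (cont_eta eta i) (cont_ext M ext star act j)"
proof -
  interpret weak_mendler_monad Ty U M eta ext star act i j
    using assms(2,3) by (rule weak_mendler_monad.intro)
  show ?thesis
    by (rule kleisli_triple_cont_cat)
qed

end
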